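(* Let $M$ be a finitely generated preGarside monoid, equipped with a length $\ell_S$. Then $d_3\le d_1$, i.e. $d_3(u,v)\le d_1(u,v)$ for all $u,v\in M$.
   Context: $a\preceq b$ means $b=ac$ for some $c\in M$; $b\succeq a$ means $b=ca$ for some $c$. A monoid $M$ is atomic if there is a norm $\nu:M\to\mathbb N$ with $\nu(a)>0$ for $a\neq1$ and $\nu(ab)\ge\nu(a)+\nu(b)$. $M$ is preGarside if it is atomic, left and right cancellative, any $a,b\in M$ having a common right multiple have a least one (for $\preceq$), and any $a,b$ having a common left multiple have a least one (for right divisibility). $S=\mathcal S(M)$ is the (finite) set of atoms. A length $\ell_S:M\to\mathbb N$ is a map with $\ell_S(ab)=\ell_S(a)+\ell_S(b)$, $\ell_S(a)>0$ for $a\ne 1$ and $\ell_S(s)=1$ for all $s\in S$. $M_{\mathrm{red}}\subseteq M$ is the fixed subset carrying the "preGarside structure" of Bessis–Digne–Michel ("Springer theory in braid groups and the Birman–Ko–Lee monoid"); the properties used are: it contains $1$ and $S$, it contains all left and right divisors of its elements, and for every $u\in M$ the set $\{v\in M_{\mathrm{red}}:v\preceq u\}$ has a unique maximal element $\alpha(u)$ for $\preceq$ (every member of the set left-divides $\alpha(u)$), where $\alpha:M\to M_{\mathrm{red}}$ is the identity on $M_{\mathrm{red}}$ and satisfies $\alpha(uv)=\alpha(u\alpha(v))$ for all $u,v\in M$. (For an Artin monoid, $M_{\mathrm{red}}$ is the set of elements having the same length as their image in the Coxeter group.) Greedy normal form: for $u\neq1$, $\iota_1(u)=(u_1,\dots,u_n)$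 is the unique sequence in $M_{\mathrm{red}}\setminus\{1\}$ with $u=u_1\cdots u_n$ and $u_i=\alpha(u_i\cdots u_n)$ for all $i$; $\iota_1(1)$ is the empty sequence. Prefix form: $\mathrm{Pref}_k(u)=\{v\in M: v\preceq u,\ \ell_S(v)=k\}$; for $u\ne1$, $\iota_3(u)=(\mathrm{Pref}_1(u),\dots,\mathrm{Pref}_{\ell_S(u)}(u))$, and $\iota_3(1)=(\{1\})$. For $i\in\{1,3\}$ and $u\ne v$, $r_i(u,v)$ is the largest $k\ge0$ such that the sequences $\iota_i(u),\iota_i(v)$ both have at least $k$ terms and agree in their first $k$ terms; $r_i(u,u)=\infty$; $d_i(u,v)=2^{-r_i(u,v)}$ with $2^{-\infty}=0$. *)

theory Defs
  imports Complex_Main "HOL-Library.Extended_Nat"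
begin

text \<open>
  In a possibly non-commutative monoid, the library relation \<open>a dvd b\<close> unfolds to
  \<open>\<exists>k. b = a * k\<close>; it is the left divisibility usually written \<open>a \<preceq> b\<close>.
  The class \<open>dvd\<close> in the sort only makes this definition available and carries no axioms.
\<close>

context times
begin

definition right_dvd :: "'a \<Rightarrow> 'a \<Rightarrow> bool"  (infix "rdvd" 50)
  where "a rdvd b \<longleftrightarrow> (\<exists>c. b = c * a)"

end

class pregarside_monoid = monoid_mult + dvd +
  assumes atomic: "\<exists>\<nu> :: 'a \<Rightarrow> nat. (\<forall>a. a \<noteq> 1 \<longrightarrow> \<nu> a > 0) \<and> (\<forall>a b. \<nu> (a * b) \<ge> \<nu> a + \<nu> b)"
    and left_cancel: "c * a = c * b \<Longrightarrow> a = b"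
    and right_cancel: "a * c = b * c \<Longrightarrow> a = b"
    and least_common_right_multiple:
      "a dvd n \<Longrightarrow> b dvd n \<Longrightarrow> \<exists>m. a dvd m \<and> b dvd m \<and> (\<forall>m'. a dvd m' \<and> b dvd m' \<longrightarrow> m dvd m')"
    and least_common_left_multiple:
      "a rdvd n \<Longrightarrow> b rdvd n \<Longrightarrow> \<exists>m. a rdvd m \<and> b rdvd m \<and> (\<forall>m'. a rdvd m' \<and> b rdvd m' \<longrightarrow> m rdvd m')"

definition generates :: "'a::monoid_mult set \<Rightarrow> bool"
  where "generates X \<longleftrightarrow> (\<forall>a. \<exists>xs. set xs \<subseteq> X \<and> prod_list xs = a)"

definition atoms :: "'a::monoid_mult set"
  where "atoms = {s. s \<noteq> 1 \<and> (\<forall>a b. s = a * b \<longrightarrow> a = 1 \<or> b = 1)}"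

definition is_length :: "('a::monoid_mult \<Rightarrow> nat) \<Rightarrow> bool"
  where "is_length l \<longleftrightarrow>
    (\<forall>a b. l (a * b) = l a + l b) \<and> (\<forall>a. a \<noteq> 1 \<longrightarrow> l a > 0) \<and> (\<forall>s\<in>atoms. l s = 1)"

text \<open>
  The data \<open>(M\<^sub>r\<^sub>e\<^sub>d, \<alpha>)\<close> of Bessis, Digne and Michel. By cancellation and atomicity
  left divisibility is a partial order, so \<open>alpha_in\<close>, \<open>alpha_dvd\<close> and \<open>alpha_greatest\<close> determine
  \<open>\<alpha> u\<close> as the unique maximal left divisor of \<open>u\<close> lying in \<open>M\<^sub>r\<^sub>e\<^sub>d\<close>.
\<close>

locale pregarside_structure =
  fixes Mred :: "'a::pregarside_monoid set" and \<alpha> :: "'a \<Rightarrow> 'a"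
  assumes one_in: "1 \<in> Mred"
    and atoms_in: "atoms \<subseteq> Mred"
    and left_divisor_in: "b \<in> Mred \<Longrightarrow> a dvd b \<Longrightarrow> a \<in> Mred"
    and right_divisor_in: "b \<in> Mred \<Longrightarrow> a rdvd b \<Longrightarrow> a \<in> Mred"
    and alpha_in: "\<alpha> u \<in> Mred"
    and alpha_dvd: "\<alpha> u dvd u"
    and alpha_greatest: "v \<in> Mred \<Longrightarrow> v dvd u \<Longrightarrow> v dvd \<alpha> u"
    and alpha_id: "u \<in> Mred \<Longrightarrow> \<alpha> u = u"
    and alpha_mult: "\<alpha> (u * v) = \<alpha> (u * \<alpha> v)"

definition is_greedy_nf :: "'a::monoid_mult set \<Rightarrow> ('a \<Rightarrow> 'a) \<Rightarrow> 'a \<Rightarrow> 'a list \<Rightarrow> bool"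
  where "is_greedy_nf Mred \<alpha> u us \<longleftrightarrow>
    set us \<subseteq> Mred - {1} \<and> u = prod_list us \<and>
    (\<forall>i<length us. us ! i = \<alpha> (prod_list (drop i us)))"

definition iota1 :: "'a::monoid_mult set \<Rightarrow> ('a \<Rightarrow> 'a) \<Rightarrow> 'a \<Rightarrow> 'a list"
  where "iota1 Mred \<alpha> u = (if u = 1 then [] else (THE us. is_greedy_nf Mred \<alpha> u us))"

definition Pref :: "('a::pregarside_monoid \<Rightarrow> nat) \<Rightarrow> nat \<Rightarrow> 'a \<Rightarrow> 'a set"
  where "Pref l k u = {v. v dvd u \<and> l v = k}"

definition iota3 :: "('a::pregarside_monoid \<Rightarrow> nat) \<Rightarrow> 'a \<Rightarrow> 'a set list"
  where "iota3 l u = (if u = 1 then [{1}] else map (\<lambda>k. Pref l k u) [1..<Suc (l u)])"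

text \<open>
  The functions \<open>r\<^sub>i\<close> and \<open>d\<^sub>i\<close>, for an arbitrary encoding \<open>\<iota>\<close> of elements by finite sequences.
  The length bounds matter: \<open>take k xs = take k ys\<close> alone also holds for equal lists of length
  less than \<open>k\<close>.
\<close>

definition agreement :: "('a \<Rightarrow> 'b list) \<Rightarrow> 'a \<Rightarrow> 'a \<Rightarrow> enat"
  where "agreement \<iota> u v =
    (if u = v then \<infinity>
     else enat (GREATEST k. k \<le> length (\<iota> u) \<and> k \<le> length (\<iota> v) \<and> take k (\<iota> u) = take k (\<iota> v)))"

definition seq_dist :: "('a \<Rightarrow> 'b list) \<Rightarrow> 'a \<Rightarrow> 'a \<Rightarrow> real"
  where "seq_dist \<iota> u v = (case agreement \<iota> u v of enat k \<Rightarrow> 2 powr (- real k) | \<infinity> \<Rightarrow> 0)"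

definition d1 :: "'a::monoid_mult set \<Rightarrow> ('a \<Rightarrow> 'a) \<Rightarrow> 'a \<Rightarrow> 'a \<Rightarrow> real"
  where "d1 Mred \<alpha> = seq_dist (iota1 Mred \<alpha>)"

definition d3 :: "('a::pregarside_monoid \<Rightarrow> nat) \<Rightarrow> 'a \<Rightarrow> 'a \<Rightarrow> real"
  where "d3 l = seq_dist (iota3 l)"

end

theory Submission
  imports Defs
begin

text \<open>
  Let \<open>u\<^sub>1, \<dots>, u\<^sub>n\<close> be the greedy normal form of \<open>u\<close>. The point is that its first \<open>k\<close> terms know
  every left divisor of \<open>u\<close> of length \<open>k\<close>: such a divisor is a product of \<open>k\<close> atoms, and any
  product of \<open>k\<close> elements of \<open>M\<^sub>r\<^sub>e\<^sub>d\<close> that left-divides \<open>u\<close> already left-divides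
  \<open>u\<^sub>1 \<cdots> u\<^sub>k\<close> (\<open>reduced_product_dvd_greedy_prefix\<close>). Hence \<open>Pref\<^sub>k(u)\<close> is the set of left divisors
  of \<open>u\<^sub>1 \<cdots> u\<^sub>k\<close> of length \<open>k\<close>, and two elements whose normal forms share \<open>k\<close> terms share
  \<open>Pref\<^sub>1, \<dots>, Pref\<^sub>k\<close>. Since the terms of a normal form are nontrivial, \<open>n\<close> is at most the length
  of \<open>u\<close>, so these prefix sets do occur in \<open>\<iota>\<^sub>3(u)\<close>. Thus \<open>r\<^sub>1 \<le> r\<^sub>3\<close>, that is, \<open>d\<^sub>3 \<le> d\<^sub>1\<close>.

  The divisibility claim goes by induction on \<open>k\<close>, peeling factors off on the right. If the
  product \<open>v\<close> of the first \<open>k\<close> factors satisfies \<open>u\<^sub>1 \<cdots> u\<^sub>k = v c\<close> and \<open>x\<close> is the next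
  factor, then cancelling \<open>v\<close> shows that \<open>x\<close> left-divides \<open>c u\<^bsub>k+1\<^esub> \<cdots> u\<^sub>n\<close>, hence also
  \<open>\<alpha>(c u\<^bsub>k+1\<^esub> \<cdots> u\<^sub>n) = \<alpha>(c \<alpha>(u\<^bsub>k+1\<^esub> \<cdots> u\<^sub>n)) = \<alpha>(c u\<^bsub>k+1\<^esub>)\<close>, which left-divides \<open>c u\<^bsub>k+1\<^esub>\<close>.
  So \<open>v x\<close> left-divides \<open>v c u\<^bsub>k+1\<^esub> = u\<^sub>1 \<cdots> u\<^bsub>k+1\<^esub>\<close>.
\<close>

section \<open>Factorization into atoms\<close>

lemma left_dvd_trans:
  fixes a b c :: "'a::pregarside_monoid"
  assumes "a dvd b" and "b dvd c"
  shows "a dvd c"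
  using assms by (auto simp: dvd_def mult.assoc)

lemma mult_dvd_mult_left_iff:
  fixes a b c :: "'a::pregarside_monoid"
  shows "c * a dvd c * b \<longleftrightarrow> a dvd b"
  by (auto simp: dvd_def mult.assoc dest: left_cancel)

text \<open>
  Strict monotonicity is the form of atomicity that inductions on divisors use; it follows because
  the norm is superadditive and positive away from \<open>1\<close>.
\<close>

lemma ex_strictly_monotone_norm:
  "\<exists>\<nu> :: 'a::pregarside_monoid \<Rightarrow> nat.
    (\<forall>a b. a \<noteq> 1 \<longrightarrow> \<nu> b < \<nu> (a * b)) \<and> (\<forall>a b. b \<noteq> 1 \<longrightarrow> \<nu> a < \<nu> (a * b))"
proof -
  obtain \<nu> :: "'a \<Rightarrow> nat"
    where pos: "\<And>a. a \<noteq> 1 \<Longrightarrow> \<nu> a > 0" and super: "\<And>a b. \<nu> (a * b) \<ge> \<nu> a + \<nu> b"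
    using atomic by blast
  have "\<nu> b < \<nu> (a * b)" if "a \<noteq> 1" for a b
    using pos[OF that] super[of a b] by linarith
  moreover have "\<nu> a < \<nu> (a * b)" if "b \<noteq> 1" for a b
    using pos[OF that] super[of a b] by linarith
  ultimately show ?thesis
    by blast
qed

lemma eq_one_if_mult_eq_one:
  fixes a b :: "'a::pregarside_monoid"
  assumes "a * b = 1"
  shows "a = 1"
proof (rule ccontr)
  assume "a \<noteq> 1"
  obtain \<nu> :: "'a \<Rightarrow> nat"
    where mono: "\<And>a b. a \<noteq> 1 \<Longrightarrow> \<nu> b < \<nu> (a * b)"
    using ex_strictly_monotone_norm by blast
  have "\<nu> b < \<nu> 1"
    using mono[OF \<open>a \<noteq> 1\<close>, of b] assms by simp
  moreover have "b \<noteq> 1"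
    using \<open>a \<noteq> 1\<close> assms by auto
  then have "\<nu> 1 < \<nu> b"
    using mono[of b 1] by simp
  ultimately show False
    by simp
qed

text \<open>A nontrivial left divisor of minimal norm is an atom.\<close>

lemma ex_atom_dvd:
  fixes u :: "'a::pregarside_monoid"
  assumes "u \<noteq> 1"
  obtains s where "s \<in> atoms" and "s dvd u"
proof -
  obtain \<nu> :: "'a \<Rightarrow> nat"
    where less: "\<And>a b. b \<noteq> 1 \<Longrightarrow> \<nu> a < \<nu> (a * b)"
    using ex_strictly_monotone_norm by blast
  have "u \<noteq> 1 \<and> u dvd u"
    using assms by (metis dvd_def mult.right_neutral)
  then obtain s where s: "s \<noteq> 1" "s dvd u"
    and least: "\<And>t. t \<noteq> 1 \<and> t dvd u \<Longrightarrow> \<nu> s \<le> \<nu> t"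
    using arg_min_nat_lemma[of "\<lambda>t. t \<noteq> 1 \<and> t dvd u" u \<nu>] by blast
  have "a = 1 \<or> b = 1" if "s = a * b" for a b
  proof (rule ccontr)
    assume *: "\<not> (a = 1 \<or> b = 1)"
    have "a dvd u"
      using s(2) that by (auto simp: dvd_def mult.assoc)
    with * least have "\<nu> s \<le> \<nu> a"
      by blast
    moreover have "\<nu> a < \<nu> s"
      using * less that by blast
    ultimately show False
      by simp
  qed
  with s have "s \<in> atoms"
    by (auto simp: atoms_def)
  with s(2) show thesis
    using that by blast
qed

lemma ex_atom_factorization:
  fixes u :: "'a::pregarside_monoid"
  shows "\<exists>xs. set xs \<subseteq> atoms \<and> prod_list xs = u"
proof -
  obtain \<nu> :: "'a \<Rightarrow> nat"
    where mono: "\<And>a b. a \<noteq> 1 \<Longrightarrow> \<nu> b < \<nu> (a * b)"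
    using ex_strictly_monotone_norm by blast
  show ?thesis
  proof (induction u rule: measure_induct_rule[of \<nu>])
    case (less u)
    show ?case
    proof (cases "u = 1")
      case True
      then show ?thesis
        by (intro exI[of _ "[]"]) simp
    next
      case False
      then obtain s w where s: "s \<in> atoms" and u: "u = s * w"
        by (metis ex_atom_dvd dvd_def)
      from s have "s \<noteq> 1"
        by (simp add: atoms_def)
      with u have "\<nu> w < \<nu> u"
        using mono by blast
      then obtain xs where "set xs \<subseteq> atoms" "prod_list xs = w"
        using less.IH by blast
      with s u show ?thesis
        by (intro exI[of _ "s # xs"]) simp
    qed
  qed
qed

section \<open>Lengths of products\<close>

lemma is_length_one:
  assumes "is_length l"
  shows "l 1 = 0"
proof -
  have "l (1 * 1) = l 1 + l 1"
    using assms unfolding is_length_def by blast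
  then show ?thesis
    by simp
qed

lemma is_length_prod_atoms:
  assumes "is_length l" and "set xs \<subseteq> atoms"
  shows "l (prod_list xs) = length xs"
  using assms(2)
proof (induction xs)
  case Nil
  then show ?case
    using is_length_one[OF assms(1)] by simp
next
  case (Cons x xs)
  then show ?case
    using assms(1) by (simp add: is_length_def)
qed

lemma length_le_is_length_prod:
  assumes "is_length l" and "1 \<notin> set xs"
  shows "length xs \<le> l (prod_list xs)"
  using assms(2)
proof (induction xs)
  case Nil
  then show ?case
    by simp
next
  case (Cons x xs)
  then have "l x > 0"
    using assms(1) by (auto simp: is_length_def)
  moreover have "l (prod_list (x # xs)) = l x + l (prod_list xs)"
    using assms(1) by (simp add: is_length_def)
  ultimately show ?case
    using Cons by simp
qed

section \<open>Greedy normal forms\<close>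

lemma is_greedy_nf_Nil: "is_greedy_nf Mred \<alpha> u [] \<longleftrightarrow> u = 1"
  by (auto simp: is_greedy_nf_def)

lemma is_greedy_nf_prod_list: "is_greedy_nf Mred \<alpha> u us \<Longrightarrow> prod_list us = u"
  by (simp add: is_greedy_nf_def)

text \<open>
  The equations point towards \<open>x\<close> and \<open>u\<close>, as rewriting with \<open>x = \<alpha> u\<close> and \<open>u = x * prod_list xs\<close>
  together would not terminate.
\<close>

lemma is_greedy_nf_Cons:
  "is_greedy_nf Mred \<alpha> u (x # xs) \<longleftrightarrow>
    x \<in> Mred - {1} \<and> \<alpha> u = x \<and> x * prod_list xs = u \<and> is_greedy_nf Mred \<alpha> (prod_list xs) xs"
proof (cases "x * prod_list xs = u")
  case True
  have "is_greedy_nf Mred \<alpha> u (x # xs) \<longleftrightarrow>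
      x \<in> Mred - {1} \<and> x = \<alpha> u \<and> is_greedy_nf Mred \<alpha> (prod_list xs) xs"
    unfolding is_greedy_nf_def by (simp add: All_less_Suc2 True conj_ac)
  with True show ?thesis
    by metis
next
  case False
  then have "\<not> is_greedy_nf Mred \<alpha> u (x # xs)"
    using is_greedy_nf_prod_list[of Mred \<alpha> u "x # xs"] by auto
  with False show ?thesis
    by blast
qed

lemma is_greedy_nf_one_notin: "is_greedy_nf Mred \<alpha> u us \<Longrightarrow> 1 \<notin> set us"
  unfolding is_greedy_nf_def by blast

context pregarside_structure
begin

text \<open>The head must be \<open>\<alpha> u\<close>, and left cancellation then determines the product of the tail.\<close>

lemma is_greedy_nf_unique:
  assumes "is_greedy_nf Mred \<alpha> u us" and "is_greedy_nf Mred \<alpha> u vs"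
  shows "us = vs"
  using assms
proof (induction us arbitrary: u vs)
  case Nil
  show ?case
  proof (cases vs)
    case (Cons y ys)
    \<comment> \<open>The head \<open>y = \<alpha> 1\<close> would be \<open>1\<close>, since \<open>1\<close> is reduced.\<close>
    with Nil show ?thesis
      using alpha_id[OF one_in] by (auto simp: is_greedy_nf_Nil is_greedy_nf_Cons)
  qed simp
next
  case (Cons x xs)
  show ?case
  proof (cases vs)
    case Nil
    with Cons.prems show ?thesis
      using alpha_id[OF one_in] by (auto simp: is_greedy_nf_Nil is_greedy_nf_Cons)
  next
    case (Cons y ys)
    with Cons.prems have "\<alpha> u = x" "x * prod_list xs = u" and "\<alpha> u = y" "y * prod_list ys = u"
      by (simp_all add: is_greedy_nf_Cons)
    then have xy: "x = y" and "x * prod_list xs = x * prod_list ys"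
      by simp_all
    then have "prod_list xs = prod_list ys"
      using left_cancel by blast
    with Cons.prems Cons have "is_greedy_nf Mred \<alpha> (prod_list xs) xs"
        and "is_greedy_nf Mred \<alpha> (prod_list xs) ys"
      by (simp_all add: is_greedy_nf_Cons)
    then have "xs = ys"
      by (rule Cons.IH)
    with xy Cons show ?thesis
      by simp
  qed
qed

text \<open>Some atom divides \<open>u\<close>, and it is reduced, so it divides \<open>\<alpha> u\<close>.\<close>

lemma alpha_ne_one:
  assumes "u \<noteq> 1"
  shows "\<alpha> u \<noteq> 1"
proof
  assume "\<alpha> u = 1"
  obtain s where s: "s \<in> atoms" "s dvd u"
    using assms by (rule ex_atom_dvd)
  then have "s dvd 1"
    using alpha_greatest[of s u] atoms_in \<open>\<alpha> u = 1\<close> by auto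
  then have "s = 1"
    by (metis dvd_def eq_one_if_mult_eq_one)
  with s(1) show False
    by (simp add: atoms_def)
qed

lemma ex_greedy_nf: "\<exists>us. is_greedy_nf Mred \<alpha> u us"
proof -
  obtain \<nu> :: "'a \<Rightarrow> nat"
    where mono: "\<And>a b. a \<noteq> 1 \<Longrightarrow> \<nu> b < \<nu> (a * b)"
    using ex_strictly_monotone_norm by blast
  show ?thesis
  proof (induction u rule: measure_induct_rule[of \<nu>])
    case (less u)
    show ?case
    proof (cases "u = 1")
      case True
      then show ?thesis
        using is_greedy_nf_Nil by blast
    next
      case False
      obtain w where u: "\<alpha> u * w = u"
        using alpha_dvd[of u] by (metis dvd_def)
      then have "\<nu> w < \<nu> u"
        using mono[OF alpha_ne_one[OF False]] by metis
      then obtain ws where ws: "is_greedy_nf Mred \<alpha> w ws"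
        using less by blast
      then have "w = prod_list ws"
        by (simp add: is_greedy_nf_prod_list)
      with u ws have "is_greedy_nf Mred \<alpha> u (\<alpha> u # ws)"
        using alpha_ne_one[OF False] alpha_in by (simp add: is_greedy_nf_Cons)
      then show ?thesis
        by blast
    qed
  qed
qed

lemma is_greedy_nf_iota1: "is_greedy_nf Mred \<alpha> u (iota1 Mred \<alpha> u)"
proof (cases "u = 1")
  case True
  then show ?thesis
    by (simp add: iota1_def is_greedy_nf_Nil)
next
  case False
  have "\<exists>!us. is_greedy_nf Mred \<alpha> u us"
    using ex_greedy_nf is_greedy_nf_unique by blast
  with False show ?thesis
    unfolding iota1_def by (simp add: theI')
qed

section \<open>Divisors seen by an initial segment of the normal form\<close>

text \<open>
  The rule \<open>\<alpha> (c w) = \<alpha> (c \<alpha> w)\<close> says that a single reduced element dividing \<open>c w\<close> cannot reach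
  beyond the first greedy factor of \<open>w\<close>.
\<close>

lemma reduced_dvd_mult_alpha:
  assumes "x \<in> Mred" and "x dvd c * w"
  shows "x dvd c * \<alpha> w"
proof -
  have "x dvd \<alpha> (c * \<alpha> w)"
    using alpha_greatest[OF assms] by (simp add: alpha_mult[of c w])
  then show ?thesis
    using alpha_dvd left_dvd_trans by blast
qed

text \<open>
  Induction adds factors on the right: the factors found so far cancel from \<open>u\<close>, and what the last
  factor has to divide is then of the form treated in \<open>reduced_dvd_mult_alpha\<close>.
\<close>

lemma reduced_product_dvd_greedy_prefix:
  assumes nf: "is_greedy_nf Mred \<alpha> u us"
    and "set xs \<subseteq> Mred" and "prod_list xs dvd u"
  shows "prod_list xs dvd prod_list (take (length xs) us)"
  using assms(2,3)
proof (induction xs rule: rev_induct)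
  case Nil
  show ?case
    by (simp add: dvd_def)
next
  case (snoc x xs)
  let ?k = "length xs"
  have u: "u = prod_list us"
    using nf by (simp add: is_greedy_nf_prod_list)
  show ?case
  proof (cases "?k < length us")
    case False
    \<comment> \<open>The normal form is exhausted, so the prefix is all of \<open>u\<close>.\<close>
    with snoc.prems u show ?thesis
      by simp
  next
    case True
    let ?w = "prod_list (drop ?k us)"
    have "prod_list xs dvd prod_list xs * x"
      by (auto simp: dvd_def)
    with snoc.prems have "prod_list xs dvd u"
      by (auto intro: left_dvd_trans)
    with snoc have "prod_list xs dvd prod_list (take ?k us)"
      by simp
    then obtain c where c: "prod_list (take ?k us) = prod_list xs * c"
      by (auto simp: dvd_def)
    have "u = prod_list (take ?k us) * ?w"
      using u by (metis append_take_drop_id prod_list.append)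
    then have "u = prod_list xs * (c * ?w)"
      by (simp add: c mult.assoc)
    with snoc.prems have "x dvd c * ?w"
      by (simp add: mult_dvd_mult_left_iff)
    then have "x dvd c * \<alpha> ?w"
      using snoc.prems by (intro reduced_dvd_mult_alpha) simp_all
    moreover have "\<alpha> ?w = us ! ?k"
      using nf True by (simp add: is_greedy_nf_def)
    ultimately have "prod_list xs * x dvd prod_list xs * (c * us ! ?k)"
      by (simp add: mult_dvd_mult_left_iff)
    also have "prod_list xs * (c * us ! ?k) = prod_list (take (Suc ?k) us)"
      using True by (simp add: take_Suc_conv_app_nth c mult.assoc)
    finally show ?thesis
      by simp
  qed
qed

lemma Pref_eq_Pref_greedy_prefix:
  assumes l: "is_length l" and nf: "is_greedy_nf Mred \<alpha> u us"
  shows "Pref l k u = Pref l k (prod_list (take k us))"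
proof -
  have "v dvd prod_list (take k us)" if "v dvd u" and "l v = k" for v
  proof -
    obtain xs where xs: "set xs \<subseteq> atoms" "prod_list xs = v"
      using ex_atom_factorization by blast
    then have "length xs = k"
      using is_length_prod_atoms[OF l, of xs] \<open>l v = k\<close> by simp
    with xs that(1) show ?thesis
      using reduced_product_dvd_greedy_prefix[OF nf, of xs] atoms_in by auto
  qed
  moreover have "prod_list (take k us) dvd u"
  proof -
    have "u = prod_list (take k us) * prod_list (drop k us)"
      using nf by (metis append_take_drop_id prod_list.append is_greedy_nf_prod_list)
    then show ?thesis
      by (auto simp: dvd_def)
  qed
  ultimately show ?thesis
    by (auto simp: Pref_def intro: left_dvd_trans)
qed

lemma length_iota1_le:
  assumes "is_length l"
  shows "length (iota1 Mred \<alpha> u) \<le> l u"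
proof -
  have "1 \<notin> set (iota1 Mred \<alpha> u)"
    using is_greedy_nf_iota1 by (rule is_greedy_nf_one_notin)
  then have "length (iota1 Mred \<alpha> u) \<le> l (prod_list (iota1 Mred \<alpha> u))"
    by (rule length_le_is_length_prod[OF assms])
  also have "prod_list (iota1 Mred \<alpha> u) = u"
    using is_greedy_nf_iota1 by (rule is_greedy_nf_prod_list)
  finally show ?thesis .
qed

end

section \<open>Comparison of the two distances\<close>

lemma length_iota3_ge:
  assumes "is_length l"
  shows "l u \<le> length (iota3 l u)"
  using is_length_one[OF assms] by (simp add: iota3_def)

lemma take_iota3:
  assumes "u \<noteq> 1" and "k \<le> l u"
  shows "take k (iota3 l u) = map (\<lambda>j. Pref l j u) [1..<Suc k]"
  using assms by (simp add: iota3_def take_map take_upt del: upt_Suc)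

text \<open>
  The candidates for the agreement are bounded by the length of either sequence and include \<open>0\<close>, so
  \<open>GREATEST\<close> really picks one of them.
\<close>

lemma seq_dist_mono:
  assumes "\<And>k. \<lbrakk>k \<le> length (\<iota> u); k \<le> length (\<iota> v); take k (\<iota> u) = take k (\<iota> v)\<rbrakk>
      \<Longrightarrow> k \<le> length (\<iota>' u) \<and> k \<le> length (\<iota>' v) \<and> take k (\<iota>' u) = take k (\<iota>' v)"
  shows "seq_dist \<iota>' u v \<le> seq_dist \<iota> u v"
proof (cases "u = v")
  case True
  then show ?thesis
    by (simp add: seq_dist_def agreement_def)
next
  case False
  define P where
    "P k \<longleftrightarrow> k \<le> length (\<iota> u) \<and> k \<le> length (\<iota> v) \<and> take k (\<iota> u) = take k (\<iota> v)" for k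
  define P' where
    "P' k \<longleftrightarrow> k \<le> length (\<iota>' u) \<and> k \<le> length (\<iota>' v) \<and> take k (\<iota>' u) = take k (\<iota>' v)" for k
  have "P (GREATEST k. P k)"
    by (rule GreatestI_nat[of P 0 "length (\<iota> u)"]) (simp_all add: P_def)
  then have "P' (GREATEST k. P k)"
    using assms by (simp add: P_def P'_def)
  then have "(GREATEST k. P k) \<le> (GREATEST k. P' k)"
    by (rule Greatest_le_nat[of P' _ "length (\<iota>' u)"]) (simp add: P'_def)
  with False show ?thesis
    by (simp add: seq_dist_def agreement_def P_def P'_def)
qed

theorem proposition3p2:
  fixes Mred :: "'a::pregarside_monoid set" and \<alpha> :: "'a \<Rightarrow> 'a" and l\<^sub>S :: "'a \<Rightarrow> nat"
  assumes "\<exists>X :: 'a set. finite X \<and> generates X"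
    and "pregarside_structure Mred \<alpha>"
    and "is_length l\<^sub>S"
  shows "\<forall>u v. d3 l\<^sub>S u v \<le> d1 Mred \<alpha> u v"
proof (intro allI)
  fix u v :: 'a
  interpret pregarside_structure Mred \<alpha>
    by (fact assms(2))
  let ?\<iota> = "iota1 Mred \<alpha>"
  show "d3 l\<^sub>S u v \<le> d1 Mred \<alpha> u v"
    unfolding d1_def d3_def
  proof (rule seq_dist_mono)
    fix k
    assume k: "k \<le> length (?\<iota> u)" "k \<le> length (?\<iota> v)" and eq: "take k (?\<iota> u) = take k (?\<iota> v)"
    have le: "k \<le> l\<^sub>S u" "k \<le> l\<^sub>S v"
      using k length_iota1_le[OF assms(3)] le_trans by blast+
    have "Pref l\<^sub>S j u = Pref l\<^sub>S j v" if "j \<le> k" for j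
    proof -
      have "take j (?\<iota> u) = take j (?\<iota> v)"
        using eq that by (metis min.absorb1 take_take)
      then show ?thesis
        using Pref_eq_Pref_greedy_prefix[OF assms(3) is_greedy_nf_iota1] by metis
    qed
    then have prefs: "map (\<lambda>j. Pref l\<^sub>S j u) [1..<Suc k] = map (\<lambda>j. Pref l\<^sub>S j v) [1..<Suc k]"
      by (auto simp del: upt_Suc)
    have "take k (iota3 l\<^sub>S u) = take k (iota3 l\<^sub>S v)"
    proof (cases "k = 0")
      case False
      \<comment> \<open>As \<open>\<iota>\<^sub>1(1)\<close> is empty, a common first term rules out the exceptional sequence \<open>\<iota>\<^sub>3(1)\<close>.\<close>
      with k have "u \<noteq> 1" and "v \<noteq> 1"
        by (auto simp: iota1_def)
      with le prefs show ?thesis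
        by (simp add: take_iota3)
    qed simp
    with le show "k \<le> length (iota3 l\<^sub>S u) \<and> k \<le> length (iota3 l\<^sub>S v) \<and>
        take k (iota3 l\<^sub>S u) = take k (iota3 l\<^sub>S v)"
      using length_iota3_ge[OF assms(3)] le_trans by blast
  qed
qed

end
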